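(* Let $\mathbb{K}$ be $\mathbb{R}$ or $\mathbb{C}$, let $n\in\mathbb{N}$ and let $T$ be a supercyclic continuous linear operator on an infinite dimensional topological vector space $X$ over $\mathbb{K}$. Then for any pairwise different non-zero $z_1,\dots,z_n\in\mathbb{K}$, the operator $z_1T\oplus\dots\oplus z_nT$ on $X^n$ is cyclic.
   Context: All topological vector spaces are assumed Hausdorff (not necessarily locally convex). $\mathbb{N}$ is the set of positive integers, $\mathbb{Z}_+$ the set of non-negative integers. A continuous linear operator $T$ on a topological vector space $X$ over $\mathbb{K}$ is supercyclic if there is $x\in X$ such that $\{sT^kx:s\in\mathbb{K},\ k\in\mathbb{Z}_+\}$ is dense in $X$; it is cyclic if there is $x\in X$ such that the linear span of $\{T^kx:k\in\mathbb{Z}_+\}$ is dense in $X$. The direct sum acts by $(z_1T\oplus\dots\oplus z_nT)(x_1,\dots,x_n)=(z_1Tx_1,\dots,z_nTx_n)$. *)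

theory Defs
  imports "HOL-Analysis.Analysis"
begin

text \<open>
  The scalar multiplication is a parameter rather than a type class operation, so that real and
  complex spaces are instances of the same definitions. Local convexity is not required.
\<close>

locale topological_vector_space = vector_space smul
  for smul :: "'k::real_normed_field \<Rightarrow> 'a::{topological_ab_group_add, t2_space} \<Rightarrow> 'a" +
  assumes continuous_scale: "continuous_on UNIV (\<lambda>(c, x). smul c x)"

definition infinite_dimensional :: "('k::field \<Rightarrow> 'a::ab_group_add \<Rightarrow> 'a) \<Rightarrow> bool" where
  "infinite_dimensional smul \<longleftrightarrow> \<not> (\<exists>B. finite B \<and> module.span smul B = UNIV)"

definition continuous_linear_operator ::
    "('k::field \<Rightarrow> 'a::{ab_group_add, topological_space} \<Rightarrow> 'a) \<Rightarrow> ('a \<Rightarrow> 'a) \<Rightarrow> bool" where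
  "continuous_linear_operator smul T \<longleftrightarrow>
     Vector_Spaces.linear smul smul T \<and> continuous_on UNIV T"

definition supercyclic_operator ::
    "('k::field \<Rightarrow> 'a::{ab_group_add, topological_space} \<Rightarrow> 'a) \<Rightarrow> ('a \<Rightarrow> 'a) \<Rightarrow> bool" where
  "supercyclic_operator smul T \<longleftrightarrow>
     (\<exists>x. closure {smul s ((T ^^ k) x) | s k. True} = UNIV)"

definition cyclic_operator ::
    "('k::field \<Rightarrow> 'a::{ab_group_add, topological_space} \<Rightarrow> 'a) \<Rightarrow> ('a \<Rightarrow> 'a) \<Rightarrow> bool" where
  "cyclic_operator smul T \<longleftrightarrow>
     (\<exists>x. closure (module.span smul {(T ^^ k) x | k. True}) = UNIV)"

text \<open>
  The power \<open>X\<^sup>n\<close> is the type \<open>'a ^ 'n\<close> with \<open>n = CARD('n)\<close>, whose library topology is the product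
  topology. Scaling is componentwise for the given scalar multiplication.
\<close>

definition vec_scale :: "('k \<Rightarrow> 'a \<Rightarrow> 'a) \<Rightarrow> 'k \<Rightarrow> 'a ^ 'n \<Rightarrow> 'a ^ 'n" where
  "vec_scale smul c x = (\<chi> i. smul c (x $ i))"

definition direct_sum_multiples ::
    "('k \<Rightarrow> 'a \<Rightarrow> 'a) \<Rightarrow> ('n \<Rightarrow> 'k) \<Rightarrow> ('a \<Rightarrow> 'a) \<Rightarrow> 'a ^ 'n \<Rightarrow> 'a ^ 'n" where
  "direct_sum_multiples smul z T x = (\<chi> i. smul (z i) (T (x $ i)))"

instance vec :: (topological_monoid_add, finite) topological_monoid_add
proof
  fix a b :: "'a ^ 'b"
  have fst: "((\<lambda>p. fst p $ i) \<longlongrightarrow> a $ i) (nhds a \<times>\<^sub>F nhds b)" for i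
    by (intro tendsto_vec_nth filterlim_fst)
  have snd: "((\<lambda>p. snd p $ i) \<longlongrightarrow> b $ i) (nhds a \<times>\<^sub>F nhds b)" for i
    by (intro tendsto_vec_nth filterlim_snd)
  have "((\<lambda>p. \<chi> i. fst p $ i + snd p $ i) \<longlongrightarrow> (\<chi> i. a $ i + b $ i)) (nhds a \<times>\<^sub>F nhds b)"
    by (intro tendsto_vec_lambda tendsto_add fst snd)
  then show "((\<lambda>p. fst p + snd p) \<longlongrightarrow> a + b) (nhds a \<times>\<^sub>F nhds b)"
    by (simp add: plus_vec_def)
qed

instance vec :: (topological_group_add, finite) topological_group_add
proof
  fix a :: "'a ^ 'b"
  have "((\<lambda>x. \<chi> i. - (x $ i)) \<longlongrightarrow> (\<chi> i. - (a $ i))) (nhds a)"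
    by (intro tendsto_vec_lambda tendsto_minus tendsto_vec_nth) (simp add: filterlim_ident)
  then show "(uminus \<longlongrightarrow> - a) (nhds a)"
    by (simp add: uminus_vec_def [abs_def])
qed

instance vec :: (topological_ab_group_add, finite) topological_ab_group_add ..

instance vec :: (t0_space, finite) t0_space
proof
  fix x y :: "'a ^ 'b"
  assume "x \<noteq> y"
  then obtain i where "x $ i \<noteq> y $ i"
    by (auto simp: vec_eq_iff)
  then obtain U where "open U" "\<not> (x $ i \<in> U \<longleftrightarrow> y $ i \<in> U)"
    using t0_space_class.t0_space[of "x $ i" "y $ i"] by blast
  then show "\<exists>U. open U \<and> \<not> (x \<in> U \<longleftrightarrow> y \<in> U)"
    by (intro exI[of _ "(\<lambda>v. v $ i) -` U"]) (auto intro: open_vimage_vec_nth)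
qed

instance vec :: (t1_space, finite) t1_space
proof
  fix x y :: "'a ^ 'b"
  assume "x \<noteq> y"
  then obtain i where "x $ i \<noteq> y $ i"
    by (auto simp: vec_eq_iff)
  then obtain U where "open U" "x $ i \<in> U" "y $ i \<notin> U"
    by (meson t1_space)
  then show "\<exists>U. open U \<and> x \<in> U \<and> y \<notin> U"
    by (intro exI[of _ "(\<lambda>v. v $ i) -` U"]) (auto intro: open_vimage_vec_nth)
qed

instance vec :: (t2_space, finite) t2_space
proof
  fix x y :: "'a ^ 'b"
  assume "x \<noteq> y"
  then obtain i where "x $ i \<noteq> y $ i"
    by (auto simp: vec_eq_iff)
  then obtain U V where "open U" "open V" "x $ i \<in> U" "y $ i \<in> V" "U \<inter> V = {}"
    by (meson hausdorff)
  then show "\<exists>U V. open U \<and> open V \<and> x \<in> U \<and> y \<in> V \<and> U \<inter> V = {}"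
    by (intro exI[of _ "(\<lambda>v. v $ i) -` U"] exI[of _ "(\<lambda>v. v $ i) -` V"])
       (auto intro: open_vimage_vec_nth)
qed

lemma topological_vector_space_vec_scale:
  fixes smul :: "'k::real_normed_field \<Rightarrow> 'a::{topological_ab_group_add, t2_space} \<Rightarrow> 'a"
  assumes "topological_vector_space smul"
  shows "topological_vector_space (vec_scale smul :: _ \<Rightarrow> 'a ^ 'n \<Rightarrow> _)"
proof -
  interpret topological_vector_space smul by fact
  have cont: "continuous_on UNIV (\<lambda>p. smul (fst p) (snd p $ i))" for i :: 'n
    using continuous_on_compose2[OF continuous_scale,
        where f = "\<lambda>p :: 'k \<times> ('a ^ 'n). (fst p, snd p $ i)" and s = UNIV]
    by (simp add: continuous_on_component continuous_on_Pair continuous_on_fst continuous_on_snd)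
  show ?thesis
  proof
    show "continuous_on UNIV (\<lambda>(c, x). vec_scale smul c x :: 'a ^ 'n)"
      unfolding vec_scale_def case_prod_unfold
      by (intro continuous_on_vec_lambda cont)
  qed (simp_all add: vec_scale_def vec_eq_iff scale_right_distrib scale_left_distrib)
qed

lemma continuous_linear_operator_direct_sum_multiples:
  assumes "topological_vector_space smul" and "continuous_linear_operator smul T"
  shows "continuous_linear_operator (vec_scale smul) (direct_sum_multiples smul z T)"
proof -
  interpret topological_vector_space smul by fact
  interpret V: topological_vector_space "vec_scale smul :: _ \<Rightarrow> _ ^ 'c \<Rightarrow> _"
    using assms(1) by (rule topological_vector_space_vec_scale)
  interpret T: Vector_Spaces.linear smul smul T
    using assms(2) by (simp add: continuous_linear_operator_def)
  have T: "continuous_on UNIV T"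
    using assms(2) by (simp add: continuous_linear_operator_def)
  have cont: "continuous_on UNIV (smul c)" for c
    using continuous_on_compose2[OF continuous_scale, where f = "\<lambda>x. (c, x)" and s = UNIV]
    by (simp add: continuous_intros)
  have "Vector_Spaces.linear (vec_scale smul) (vec_scale smul) (direct_sum_multiples smul z T)"
    by unfold_locales
       (simp_all add: direct_sum_multiples_def vec_scale_def vec_eq_iff T.add T.scale
          scale_right_distrib scale_left_commute)
  moreover have "continuous_on UNIV (direct_sum_multiples smul z T)"
    unfolding direct_sum_multiples_def [abs_def]
    by (intro continuous_on_vec_lambda continuous_on_compose2[OF cont]
          continuous_on_compose2[OF T] continuous_intros) auto
  ultimately show ?thesis
    by (simp add: continuous_linear_operator_def)
qed

end

theory Submission
  imports Defs
begin

text \<open>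
  Let \<open>x\<close> be a supercyclic vector and let \<open>L\<close> be the closed subspace of \<open>X\<^sup>n\<close> generated by the orbit of
  \<open>(x, \<dots>, x)\<close>. For \<open>g \<in> K\<^sup>n\<close> and \<open>y \<in> X\<close> write \<open>diag g y = (g\<^sub>1 y, \<dots>, g\<^sub>n y)\<close>. If
  \<open>diag h x \<in> L\<close>, then all vectors supported in the support \<open>J\<close> of \<open>h\<close> lie in \<open>L\<close>; this is shown by
  induction on \<open>|J|\<close>. If some \<open>diag g x \<in> L\<close> has \<open>g\<close> supported in \<open>J\<close> but not proportional to \<open>h\<close>,
  then \<open>h\<close> splits into two vectors of smaller support. Otherwise let \<open>|z\<^sub>m|\<close> be maximal in \<open>J\<close>.
  The vectors \<open>diag ((z\<^sub>i/z\<^sub>m)\<^sup>k h\<^sub>i) (s T\<^sup>k x)\<close> are in \<open>L\<close>, so by compactness each \<open>y \<in> X\<close> has a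
  multiplier \<open>g\<close> with \<open>g\<^sub>m = 1\<close>, \<open>|g\<^sub>i| \<le> 1\<close> and \<open>diag (g h) y \<in> L\<close>, where \<open>|g\<^sub>i| = 1\<close> exactly for
  maximal \<open>|z\<^sub>i|\<close>. Taking \<open>y = x\<close> shows that all \<open>|z\<^sub>i|\<close>, \<open>i \<in> J\<close>, are equal. For \<open>y = x + t u\<close> the
  multipliers solve a linear system that is the identity at \<open>t = 0\<close>, and a unimodular solution for
  all \<open>t\<close> must be constantly \<open>1\<close> near \<open>t = 0\<close>. Hence \<open>diag h u \<in> L\<close> for all \<open>u\<close>, which forces
  \<open>z h\<close> to be proportional to \<open>h\<close>, so \<open>J\<close> is a singleton.
\<close>

section \<open>Unimodular solutions of a perturbed linear system\<close>

text \<open>To first order in \<open>t\<close>, the solution is \<open>1 - t * a r\<close> with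
  \<open>a r\<close> the row sum of \<open>M\<close>. If \<open>a r\<close> were nonzero, a small
  \<open>t\<close> of suitable phase would push the norm below 1. So all row sums vanish, the
  constant 1 solves the system for every \<open>t\<close>, and for small \<open>t\<close> a
  contraction estimate makes it the only solution on \<open>J\<close>.\<close>

lemma unimodular_perturbation_trivial:
  fixes M :: "'i \<Rightarrow> 'i \<Rightarrow> 'k::real_normed_field"
  assumes "finite J"
    and ex: "\<And>t. \<exists>g. \<forall>r\<in>J. norm (g r) = 1 \<and> g r = 1 - t * (\<Sum>s\<in>J. g s * M r s)"
  obtains t where "t \<noteq> 0"
    and "\<And>g r. (\<And>q. q \<in> J \<Longrightarrow> g q = 1 - t * (\<Sum>s\<in>J. g s * M q s)) \<Longrightarrow> r \<in> J \<Longrightarrow> g r = 1"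
proof -
  define C where "C = (\<Sum>r\<in>J. \<Sum>s\<in>J. norm (M r s))"
  define a where "a r = (\<Sum>s\<in>J. M r s)" for r
  have C0: "C \<ge> 0"
    unfolding C_def by (intro sum_nonneg) auto
  have row: "(\<Sum>s\<in>J. norm (M r s)) \<le> C" if "r \<in> J" for r
    unfolding C_def using that \<open>finite J\<close>
    by (intro member_le_sum[of r J "\<lambda>r. \<Sum>s\<in>J. norm (M r s)"]) (auto intro: sum_nonneg)
  have expand: "(\<Sum>s\<in>J. g s * M r s) = a r + (\<Sum>s\<in>J. (g s - 1) * M r s)" for g r
    by (simp add: a_def flip: sum.distrib) (simp add: algebra_simps)
  have a0: "a r = 0" if r: "r \<in> J" for r
  proof (rule ccontr)
    assume ar: "a r \<noteq> 0"
    define A where "A = norm (a r)"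
    have A: "A > 0" using ar by (simp add: A_def)
    \<comment> \<open>For \<open>t = \<epsilon> / a r\<close> the solution satisfies \<open>g r = 1 - \<epsilon> + O(\<epsilon>\<^sup>2)\<close>, so its norm is below 1.\<close>
    define \<epsilon> where "\<epsilon> = A\<^sup>2 / (A\<^sup>2 + C\<^sup>2)"
    have AC: "A\<^sup>2 + C\<^sup>2 > 0" using A by (simp add: add_pos_nonneg)
    have \<epsilon>: "\<epsilon> > 0" "\<epsilon> \<le> 1"
      using A AC by (auto simp: \<epsilon>_def field_simps)
    define t where "t = of_real \<epsilon> / a r"
    have nt: "norm t = \<epsilon> / A"
      using \<epsilon> by (simp add: t_def A_def norm_divide)
    obtain g where g1: "\<And>s. s \<in> J \<Longrightarrow> norm (g s) = 1"
      and g: "\<And>q. q \<in> J \<Longrightarrow> g q = 1 - t * (\<Sum>s\<in>J. g s * M q s)"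
      using ex[of t] by blast
    have close: "norm (g q - 1) \<le> norm t * C" if "q \<in> J" for q
    proof -
      have "norm (g q - 1) = norm t * norm (\<Sum>s\<in>J. g s * M q s)"
        by (subst g[OF that]) (simp add: norm_mult)
      also have "norm (\<Sum>s\<in>J. g s * M q s) \<le> (\<Sum>s\<in>J. norm (M q s))"
        by (rule sum_norm_le) (simp add: norm_mult g1)
      also have "\<dots> \<le> C" using row that .
      finally show ?thesis by (simp add: mult_left_mono)
    qed
    have "norm (\<Sum>s\<in>J. (g s - 1) * M r s) \<le> (\<Sum>s\<in>J. (norm t * C) * norm (M r s))"
      by (rule sum_norm_le) (simp add: norm_mult close mult_right_mono)
    also have "\<dots> \<le> (norm t * C) * C"
      unfolding sum_distrib_left[symmetric] using row[OF r] C0 by (intro mult_left_mono) auto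
    finally have rest: "norm (\<Sum>s\<in>J. (g s - 1) * M r s) \<le> norm t * C * C" .
    have "g r = of_real (1 - \<epsilon>) - t * (\<Sum>s\<in>J. (g s - 1) * M r s)"
      by (subst g[OF r], subst expand) (use ar in \<open>simp add: t_def algebra_simps\<close>)
    then have "norm (g r) \<le> norm (of_real (1 - \<epsilon>) :: 'k) + norm (t * (\<Sum>s\<in>J. (g s - 1) * M r s))"
      by (metis norm_triangle_ineq4)
    also have "norm (of_real (1 - \<epsilon>) :: 'k) = 1 - \<epsilon>"
      using \<epsilon> unfolding norm_of_real by simp
    also have "norm (t * (\<Sum>s\<in>J. (g s - 1) * M r s)) \<le> norm t * (norm t * C * C)"
      unfolding norm_mult by (intro mult_left_mono rest) auto
    \<comment> \<open>The first-order loss \<open>\<epsilon>\<close> cannot exceed the second-order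
      error. The denominator in \<open>\<epsilon>\<close> was chosen to contradict this, also when
      \<open>C = 0\<close>.\<close>
    finally have "\<epsilon> \<le> \<epsilon> * (\<epsilon> * C\<^sup>2 / A\<^sup>2)"
      using g1[OF r] by (simp add: nt power2_eq_square)
    then have "1 \<le> \<epsilon> * C\<^sup>2 / A\<^sup>2"
      using \<epsilon>(1) by (metis mult.right_neutral mult_le_cancel_left_pos)
    also have "\<dots> = C\<^sup>2 / (A\<^sup>2 + C\<^sup>2)"
      using A by (simp add: \<epsilon>_def)
    also have "\<dots> < 1" using A AC by simp
    finally show False by simp
  qed
  \<comment> \<open>Adding 1 keeps the denominator positive for \<open>C = 0\<close> and gives the
    contraction factor \<open>norm t * C < 1\<close>.\<close>
  define t :: 'k where "t = of_real (1 / (C + 1))"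
  have t: "t \<noteq> 0" "norm t * C < 1"
    using C0 by (auto simp: t_def norm_divide simp flip: of_real_add of_real_divide)
  have "g r = 1" if g: "\<And>q. q \<in> J \<Longrightarrow> g q = 1 - t * (\<Sum>s\<in>J. g s * M q s)" and "r \<in> J" for g r
  proof -
    define D where "D = (\<Sum>r\<in>J. norm (g r - 1))"
    have le_D: "norm (g s - 1) \<le> D" if "s \<in> J" for s
      unfolding D_def using that \<open>finite J\<close> by (intro member_le_sum) auto
    have "norm (g q - 1) \<le> norm t * D * (\<Sum>s\<in>J. norm (M q s))" if "q \<in> J" for q
    proof -
      have "norm (g q - 1) = norm t * norm (\<Sum>s\<in>J. (g s - 1) * M q s)"
        by (subst g[OF that], subst expand) (simp add: norm_mult a0[OF that])
      also have "norm (\<Sum>s\<in>J. (g s - 1) * M q s) \<le> (\<Sum>s\<in>J. D * norm (M q s))"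
        by (rule sum_norm_le) (simp add: norm_mult le_D mult_right_mono)
      finally show ?thesis by (simp add: mult_left_mono mult.assoc sum_distrib_left)
    qed
    then have "D \<le> (\<Sum>r\<in>J. norm t * D * (\<Sum>s\<in>J. norm (M r s)))"
      unfolding D_def by (intro sum_mono) auto
    then have "D \<le> (norm t * C) * D"
      by (simp add: C_def mult.commute mult.left_commute flip: sum_distrib_left)
    moreover have "D \<ge> 0"
      unfolding D_def by (intro sum_nonneg) auto
    ultimately have "D = 0"
      using t(2) mult_strict_right_mono[of "norm t * C" 1 D] by linarith
    with le_D[OF that(2)] show ?thesis by simp
  qed
  with t(1) show ?thesis by (intro that[of t]) blast+
qed

section \<open>Algebraic and topological preliminaries\<close>

text \<open>A basis of \<open>N\<close> together with \<open>v\<close> is independent, so values on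
  it extend linearly. The functional is purely algebraic: without local convexity there may be no
  nonzero continuous ones.\<close>

lemma (in vector_space) functional_separating_subspace:
  assumes "subspace N" and "v \<notin> N"
  obtains \<psi> where "Vector_Spaces.linear scale (*) \<psi>" "\<And>w. w \<in> N \<Longrightarrow> \<psi> w = 0" "\<psi> v = 1"
proof -
  interpret K: vector_space "(*) :: 'a \<Rightarrow> 'a \<Rightarrow> 'a"
    by unfold_locales (auto simp: algebra_simps)
  interpret P: vector_space_pair scale "(*) :: 'a \<Rightarrow> 'a \<Rightarrow> 'a" ..
  obtain B where B: "B \<subseteq> N" "independent B" "N \<subseteq> span B"
    by (rule maximal_independent_subset)
  have "span B \<subseteq> N"
    using B assms(1) by (simp add: span_minimal)
  with assms(2) B have "independent (insert v B)"
    by (intro independent_insertI) auto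
  from P.linear_independent_extend[OF this, of "\<lambda>w. if w = v then 1 else 0"]
  obtain \<psi> where \<psi>: "Vector_Spaces.linear scale (*) \<psi>"
    and val: "\<forall>w\<in>insert v B. \<psi> w = (if w = v then 1 else 0)" by blast
  interpret psi: Vector_Spaces.linear scale "(*)" \<psi> by fact
  have "\<psi> w = 0" if "w \<in> N" for w
  proof -
    have "w \<in> span B" using that B by auto
    then show ?thesis
      by (rule psi.eq_0_on_span[rotated]) (use val B assms in auto)
  qed
  with \<psi> val show ?thesis by (intro that[of \<psi>]) auto
qed

text \<open>Projection along a compact factor is a closed map. This turns limits of multipliers into
  a closedness statement without choosing nets.\<close>

lemma closed_compact_projection_snd:
  fixes K :: "'a::topological_space set" and E :: "('a \<times> 'b::topological_space) set"
  assumes "compact K" "closed E"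
  shows "closed {y. \<exists>g\<in>K. (g, y) \<in> E}"
proof -
  have "closed_map (prod_topology (top_of_set K) (euclidean :: 'b topology)) euclidean snd"
    using assms(1) by (intro Abstract_Topological_Spaces.closed_map_snd)
      (simp add: compact_space_subtopology)
  moreover have "prod_topology (top_of_set K) (euclidean :: 'b topology) = top_of_set (K \<times> UNIV)"
    by (metis prod_topology_subtopology_eu subtopology_UNIV)
  ultimately have snd: "closed_map (top_of_set (K \<times> UNIV)) (euclidean :: 'b topology) snd"
    by metis
  have "closedin (top_of_set (K \<times> UNIV)) (K \<times> UNIV \<inter> E)"
    using assms(2) by (rule closedin_closed_Int)
  with snd have "closed (snd ` (K \<times> UNIV \<inter> E))"
    unfolding closed_map_def closed_closedin by blast
  moreover have "snd ` (K \<times> UNIV \<inter> E) = {y. \<exists>g\<in>K. (g, y) \<in> E}"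
    by (auto simp: image_iff Bex_def)
  ultimately show ?thesis by metis
qed

context topological_vector_space
begin

lemma continuous_on_smul [continuous_intros]:
  assumes "continuous_on S f" "continuous_on S g"
  shows "continuous_on S (\<lambda>p. smul (f p) (g p))"
  using continuous_on_compose2[OF continuous_scale continuous_on_Pair[OF assms]] by simp

lemma closure_subspace:
  assumes "subspace S"
  shows "subspace (closure S)"
proof (rule subspaceI)
  show "0 \<in> closure S"
    using closure_subset subspace_0[OF assms] by blast
next
  \<comment> \<open>Addition is extended to the closure one variable at a time.\<close>
  have 1: "a + b \<in> closure S" if "a \<in> S" "b \<in> closure S" for a b
  proof -
    have "(\<lambda>b. a + b) ` closure S \<subseteq> closure S"
    proof (rule image_closure_subset)
      show "(\<lambda>b. a + b) ` S \<subseteq> closure S"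
        using closure_subset[of S] subspace_add[OF assms that(1)] by blast
    qed (intro continuous_intros closed_closure)+
    then show ?thesis using that(2) by blast
  qed
  show "a + b \<in> closure S" if "a \<in> closure S" "b \<in> closure S" for a b
  proof -
    have "(\<lambda>a. a + b) ` closure S \<subseteq> closure S"
    proof (rule image_closure_subset)
      show "(\<lambda>a. a + b) ` S \<subseteq> closure S"
        using 1 that(2) by blast
    qed (intro continuous_intros closed_closure)+
    then show ?thesis using that(1) by blast
  qed
next
  show "smul c a \<in> closure S" if "a \<in> closure S" for c a
  proof -
    have "(\<lambda>a. smul c a) ` closure S \<subseteq> closure S"
    proof (rule image_closure_subset)
      show "(\<lambda>a. smul c a) ` S \<subseteq> closure S"
        using closure_subset[of S] subspace_scale[OF assms] by blast
    qed (intro continuous_intros closed_closure)+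
    then show ?thesis using that by blast
  qed
qed

end

section \<open>Closed lines and the tail of the orbit\<close>

text \<open>Local compactness of the scalar field makes one-dimensional subspaces closed.\<close>

locale heine_borel_tvs = topological_vector_space smul
  for smul :: "'k::{real_normed_field, heine_borel} \<Rightarrow> 'a::{topological_ab_group_add, t2_space} \<Rightarrow> 'a"
begin

lemma closed_line: "closed (range (\<lambda>s. smul s x))"
proof (cases "x = 0")
  case False
  have "y \<in> range (\<lambda>s. smul s x)" if y: "y \<in> closure (range (\<lambda>s. smul s x))" for y
  proof -
    \<comment> \<open>Since \<open>smul 0 y = 0\<close> differs from \<open>x\<close>, small scalars
      times points near \<open>y\<close> avoid \<open>x\<close>. A multiple \<open>smul s x\<close>
      near \<open>y\<close> with large \<open>s\<close> would return to \<open>x\<close> under the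
      small scalar \<open>inverse s\<close>, so near \<open>y\<close> the coefficients are bounded
      and the line is compact there.\<close>
    have "open ((\<lambda>p. smul (fst p) (snd p)) -` (- {x}))"
      by (intro open_vimage continuous_intros)
    moreover have "(0, y) \<in> (\<lambda>p. smul (fst p) (snd p)) -` (- {x})"
      using False by simp
    ultimately obtain A V where AV: "open A" "open V" "0 \<in> A" "y \<in> V"
      and sub: "A \<times> V \<subseteq> (\<lambda>p. smul (fst p) (snd p)) -` (- {x})"
      by (auto elim!: open_prod_elim)
    obtain \<delta> where \<delta>: "\<delta> > 0" "ball 0 \<delta> \<subseteq> A"
      using AV open_contains_ball by blast
    have bound: "norm s \<le> 1 / \<delta>" if "smul s x \<in> V" for s
    proof (rule ccontr)
      assume "\<not> norm s \<le> 1 / \<delta>"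
      then have s: "norm s > 1 / \<delta>" by simp
      with \<delta> have "norm s > 0" by (smt (verit) divide_pos_pos)
      with s \<delta> have "inverse s \<in> ball 0 \<delta>"
        by (simp add: norm_inverse) (simp add: field_simps)
      with \<delta> sub that have "smul (inverse s) (smul s x) \<noteq> x" by fastforce
      with \<open>norm s > 0\<close> show False by simp
    qed
    define Q where "Q = (\<lambda>s. smul s x) ` cball 0 (1 / \<delta>)"
    have "compact Q"
      unfolding Q_def
      by (intro compact_continuous_image continuous_intros) (auto simp: compact_eq_bounded_closed)
    then have "closed Q" by (rule compact_imp_closed)
    have "y \<in> closure (V \<inter> range (\<lambda>s. smul s x))"
      using y AV open_Int_closure_subset by blast
    also have "\<dots> \<subseteq> Q"
      by (rule closure_minimal[OF _ \<open>closed Q\<close>]) (use bound in \<open>auto simp: Q_def\<close>)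
    finally show ?thesis by (auto simp: Q_def)
  qed
  then show ?thesis by (metis closure_subset_eq subsetI)
qed simp

text \<open>Dropping the power 0 removes only a closed line, whose complement is dense in infinite
  dimension. The tail is what later arguments need: its vectors are in the range of
  \<open>T\<close>, and its powers are at least 1.\<close>

lemma supercyclic_tail_dense:
  fixes T :: "'a \<Rightarrow> 'a"
  assumes inf: "infinite_dimensional smul"
    and dense: "closure {smul s ((T ^^ k) x) | s k. True} = UNIV"
  shows "closure {smul s ((T ^^ Suc k) x) | s k. True} = UNIV" (is "closure ?O = UNIV")
proof -
  let ?l = "range (\<lambda>s. smul s x)"
  have "{smul s ((T ^^ k) x) | s k. True} \<subseteq> ?l \<union> closure ?O"
  proof
    fix y assume "y \<in> {smul s ((T ^^ k) x) | s k. True}"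
    then obtain s k where y: "y = smul s ((T ^^ k) x)" by blast
    show "y \<in> ?l \<union> closure ?O"
    proof (cases k)
      case 0
      with y have "y = smul s x" by simp
      then show ?thesis by blast
    next
      case (Suc j)
      then have "y \<in> ?O" using y by blast
      then show ?thesis using closure_subset[of ?O] by blast
    qed
  qed
  then have "closure {smul s ((T ^^ k) x) | s k. True} \<subseteq> ?l \<union> closure ?O"
    by (rule closure_minimal) (simp add: closed_Un closed_line)
  with dense have all: "y \<in> ?l \<or> y \<in> closure ?O" for y by blast
  have "span {x} \<noteq> UNIV"
    using inf unfolding infinite_dimensional_def by blast
  then obtain v where v: "v \<notin> ?l"
    by (auto simp: span_singleton)
  have "y \<in> closure ?O" for y
  proof (cases "y \<in> ?l")
    case True
    then obtain c where c: "y = smul c x" by blast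
    \<comment> \<open>Nonzero scalars tending to 0: the points \<open>y + smul (t j) v\<close> leave
      the line and converge to \<open>y\<close>.\<close>
    define t :: "nat \<Rightarrow> 'k" where "t j = of_real (1 / real (Suc j))" for j
    have t0: "t j \<noteq> 0" for j unfolding t_def by (simp del: of_nat_Suc)
    have "y + smul (t j) v \<notin> ?l" for j
    proof
      assume "y + smul (t j) v \<in> ?l"
      then obtain d where "y + smul (t j) v = smul d x" by blast
      then have "smul (t j) v = smul (d - c) x"
        by (simp add: c scale_left_diff_distrib algebra_simps)
      then have "v = smul (inverse (t j)) (smul (d - c) x)"
        using t0[of j] by (metis scale_one scale_scale left_inverse)
      with v show False by auto
    qed
    with all have mem: "y + smul (t j) v \<in> closure ?O" for j by blast
    have "t \<longlonglongrightarrow> 0"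
    proof -
      have "(\<lambda>j. of_real (1 / real (Suc j)) :: 'k) \<longlonglongrightarrow> of_real 0"
        by (intro tendsto_of_real LIMSEQ_Suc[OF lim_1_over_n])
      then show ?thesis by (simp add: t_def [abs_def])
    qed
    then have lim: "(\<lambda>j. y + smul (t j) v) \<longlonglongrightarrow> y + smul 0 v"
      by (intro continuous_on_tendsto_compose[of UNIV "\<lambda>c. y + smul c v"] continuous_intros) auto
    have "y + smul 0 v \<in> closure ?O"
      by (rule Lim_in_closed_set[OF closed_closure always_eventually[OF allI[OF mem]] _ lim]) simp
    then show ?thesis by simp
  next
    case False
    with all[of y] show ?thesis by simp
  qed
  then show ?thesis by blast
qed

end

section \<open>Closed invariant subspaces of the power and limit multipliers\<close>

text \<open>\<open>L\<close> is abstract here; in the theorem it becomes the closed span of the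
  orbit of the constant vector \<open>x\<close>.\<close>

locale supercyclic_multiples = heine_borel_tvs smul
  for smul :: "'k::{real_normed_field, heine_borel} \<Rightarrow> 'a::{topological_ab_group_add, t2_space} \<Rightarrow> 'a" +
  fixes T :: "'a \<Rightarrow> 'a" and x :: 'a and z :: "'n::finite \<Rightarrow> 'k" and L :: "('a ^ 'n) set"
  assumes linear_T: "Vector_Spaces.linear smul smul T"
    and tail_dense: "closure {smul s ((T ^^ Suc k) x) | s k. True} = UNIV"
    and inj_z: "inj z"
    and z_nonzero: "z i \<noteq> 0"
    and closed_L: "closed L"
    and subspace_L: "module.subspace (vec_scale smul) L"
    and invariant_L: "v \<in> L \<Longrightarrow> direct_sum_multiples smul z T v \<in> L"
begin

interpretation V: topological_vector_space "vec_scale smul :: 'k \<Rightarrow> 'a ^ 'n \<Rightarrow> 'a ^ 'n"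
  by (rule topological_vector_space_vec_scale) (rule topological_vector_space_axioms)

interpretation T: Vector_Spaces.linear smul smul T
  by (rule linear_T)

text \<open>This is the elementary tensor of \<open>g\<close> and \<open>y\<close> when the power is
  viewed as the tensor product of the coordinate space with the given space.\<close>

definition diag :: "'k ^ 'n \<Rightarrow> 'a \<Rightarrow> 'a ^ 'n" where
  "diag g y = (\<chi> i. smul (g $ i) y)"

lemma diag_nth [simp]: "diag g y $ i = smul (g $ i) y"
  by (simp add: diag_def)

lemma diag_add: "diag (g + h) y = diag g y + diag h y"
  and diag_diff: "diag (g - h) y = diag g y - diag h y"
  and diag_scale: "diag (c *s g) y = vec_scale smul c (diag g y)"
  and diag_add_right: "diag g (y + u) = diag g y + diag g u"
  and diag_scale_right: "diag g (smul c y) = vec_scale smul c (diag g y)"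
  by (simp_all add: vec_eq_iff vec_scale_def scale_left_distrib scale_left_diff_distrib
      scale_right_distrib scale_left_commute)

lemma power_diag:
  "(direct_sum_multiples smul z T ^^ k) (diag h y) = diag (\<chi> i. z i ^ k * h $ i) ((T ^^ k) y)"
  by (induction k) (simp_all add: direct_sum_multiples_def vec_eq_iff T.scale mult.assoc)

lemma power_in_L: "v \<in> L \<Longrightarrow> (direct_sum_multiples smul z T ^^ k) v \<in> L"
  by (induction k) (simp_all add: invariant_L)

lemma closed_diag_in_L: "closed {y. diag g y \<in> L}"
proof -
  have "continuous_on UNIV (diag g)"
    unfolding diag_def by (intro continuous_intros)
  then show ?thesis
    using closed_vimage[OF closed_L] by (simp add: vimage_def)
qed

text \<open>For \<open>y = smul s ((T ^^ Suc k) x)\<close> the multiplier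
  \<open>(z i / z m) ^ Suc k\<close> works: apply the power of the direct sum to
  \<open>diag h x\<close> and rescale by \<open>z m\<close>. All these multipliers lie in one
  compact set \<open>K\<close>, so the set of \<open>y\<close> having a multiplier in
  \<open>K\<close> is closed; it contains the dense tail.\<close>

lemma limit_multiplier:
  assumes h: "diag h x \<in> L" "\<And>i. i \<notin> J \<Longrightarrow> h $ i = 0"
    and m: "m \<in> J" "\<And>i. i \<in> J \<Longrightarrow> norm (z i) \<le> norm (z m)"
  obtains g where "g $ m = 1" "diag (g * h) y \<in> L"
    "\<And>i. i \<in> J \<Longrightarrow> norm (z i) = norm (z m) \<Longrightarrow> norm (g $ i) = 1"
    "\<And>i. i \<in> J \<Longrightarrow> norm (z i) < norm (z m) \<Longrightarrow> norm (g $ i) < 1"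
proof -
  \<comment> \<open>The powers start at 1, so the bound by \<open>norm (z i / z m)\<close> holds and excludes the trivial multiplier.\<close>
  define K :: "('k ^ 'n) set" where
    "K = {g. g $ m = 1} \<inter> (\<Inter>i\<in>J. {g. norm (g $ i) \<le> norm (z i / z m)}) \<inter>
         (\<Inter>i\<in>{i\<in>J. norm (z i) = norm (z m)}. {g. norm (g $ i) = 1}) \<inter> (\<Inter>i\<in>-J. {g. g $ i = 0})"
  define E where "E = (\<lambda>p. diag (fst p * h) (snd p)) -` L"
  have "closed K"
    unfolding K_def
    by (intro closed_Int closed_INT ballI closed_Collect_eq closed_Collect_le continuous_intros)
  moreover have "bounded K"
  proof -
    have "norm g \<le> real CARD('n)" if "g \<in> K" for g
    proof -
      have "norm (g $ i) \<le> 1" for i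
      proof (cases "i \<in> J")
        case True
        with that have "norm (g $ i) \<le> norm (z i / z m)"
          by (auto simp: K_def)
        also have "\<dots> \<le> 1"
          using m(2)[OF True] z_nonzero by (simp add: norm_divide)
        finally show ?thesis .
      qed (use that in \<open>simp add: K_def\<close>)
      then have "(\<Sum>i\<in>UNIV. norm (g $ i)) \<le> real CARD('n)"
        using sum_bounded_above[of UNIV "\<lambda>i. norm (g $ i)" 1] by simp
      moreover have "norm g \<le> (\<Sum>i\<in>UNIV. norm (g $ i))"
        unfolding norm_vec_def by (rule L2_set_le_sum) simp
      ultimately show ?thesis by linarith
    qed
    then show ?thesis by (rule boundedI)
  qed
  ultimately have "compact K" by (simp add: compact_eq_bounded_closed)
  have "continuous_on UNIV (\<lambda>p. diag (fst p * h) (snd p))"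
    unfolding diag_def vector_mult_component
    by (intro continuous_on_vec_lambda continuous_on_smul continuous_intros)
  then have "closed E"
    unfolding E_def by (intro closed_vimage closed_L)
  define S where "S = {y. \<exists>g\<in>K. (g, y) \<in> E}"
  have "closed S"
    unfolding S_def using \<open>compact K\<close> \<open>closed E\<close> by (rule closed_compact_projection_snd)
  moreover have "{smul s ((T ^^ Suc k) x) | s k. True} \<subseteq> S"
  proof clarify
    fix s k
    \<comment> \<open>The value 0 off \<open>J\<close> keeps the multipliers bounded and does not
      affect \<open>g * h\<close>, since \<open>h\<close> vanishes there.\<close>
    define g :: "'k ^ 'n" where "g = (\<chi> i. if i \<in> J then (z i / z m) ^ Suc k else 0)"
    have norm_g: "norm (g $ i) = norm (z i / z m) ^ Suc k" if "i \<in> J" for i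
      using that by (simp only: g_def vec_lambda_beta if_True norm_power)
    have "norm (g $ i) \<le> norm (z i / z m)" if "i \<in> J" for i
      unfolding norm_g[OF that]
      using power_decreasing[of 1 "Suc k" "norm (z i / z m)"] m(2)[OF that] z_nonzero
      by (simp add: norm_divide)
    moreover have "norm (g $ i) = 1" if "i \<in> J" "norm (z i) = norm (z m)" for i
      unfolding norm_g[OF that(1)] using that(2) z_nonzero by (simp add: norm_divide)
    moreover have "g $ m = 1" "\<And>i. i \<notin> J \<Longrightarrow> g $ i = 0"
      using m(1) z_nonzero by (simp_all add: g_def)
    ultimately have "g \<in> K"
      unfolding K_def by blast
    moreover have "(g * h) $ i = (1 / z m ^ Suc k) * (z i ^ Suc k * h $ i)" for i
      by (cases "i \<in> J") (simp_all add: g_def h(2) power_divide)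
    then have "g * h = (1 / z m ^ Suc k) *s (\<chi> i. z i ^ Suc k * h $ i)"
      by (simp add: vec_eq_iff)
    then have "diag (g * h) (smul s ((T ^^ Suc k) x)) =
        vec_scale smul s (vec_scale smul (1 / z m ^ Suc k)
          ((direct_sum_multiples smul z T ^^ Suc k) (diag h x)))"
      by (simp only: diag_scale diag_scale_right power_diag)
    then have "diag (g * h) (smul s ((T ^^ Suc k) x)) \<in> L"
      by (simp only: V.subspace_scale[OF subspace_L] power_in_L[OF h(1)])
    ultimately show "smul s ((T ^^ Suc k) x) \<in> S"
      by (auto simp: S_def E_def)
  qed
  ultimately have "S = UNIV"
    using tail_dense closure_minimal by blast
  then obtain g where g: "g \<in> K" "diag (g * h) y \<in> L"
    by (auto simp: S_def E_def)
  show ?thesis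
  proof (rule that[of g])
    show "norm (g $ i) < 1" if "i \<in> J" "norm (z i) < norm (z m)" for i
    proof -
      have "norm (g $ i) \<le> norm (z i / z m)" using g that by (auto simp: K_def)
      also have "\<dots> < 1" using that z_nonzero by (simp add: norm_divide)
      finally show ?thesis .
    qed
  qed (use g in \<open>auto simp: K_def\<close>)
qed

section \<open>The linear system for the multipliers\<close>

text \<open>By \<open>unique\<close>, nonzero vectors \<open>g * h\<close> with
  \<open>g $ m = 0\<close> give elements \<open>diag (g * h) x\<close> independent modulo
  \<open>L\<close>, so their coordinates can be read off by functionals that kill \<open>L\<close>.
  The offset 1 appears because \<open>diag h x\<close> itself is in \<open>L\<close>.\<close>

lemma coordinate_functional:
  assumes h: "diag h x \<in> L"
    and unique: "\<And>g. diag (g * h) x \<in> L \<Longrightarrow> g $ m = 0 \<Longrightarrow> g * h = 0"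
    and r: "h $ r \<noteq> 0"
  obtains \<psi> where "Vector_Spaces.linear (vec_scale smul) (*) \<psi>" "\<And>v. v \<in> L \<Longrightarrow> \<psi> v = 0"
    "\<And>g. g $ m = 1 \<Longrightarrow> \<psi> (diag (g * h) x) = g $ r - 1"
proof (cases "r = m")
  case True
  have "Vector_Spaces.linear (vec_scale smul) (*) (\<lambda>v :: 'a ^ 'n. 0 :: 'k)"
    by unfold_locales (auto simp: algebra_simps)
  with True show ?thesis by (intro that[of "\<lambda>_. 0"]) simp_all
next
  case False
  \<comment> \<open>\<open>N\<close> is the sum of \<open>L\<close> and the span of all coordinate
    directions other than \<open>m\<close> and \<open>r\<close>; the direction \<open>r\<close>
    stays outside it.\<close>
  define N where "N = {v. \<exists>c. c $ m = 0 \<and> c $ r = 0 \<and> v - diag (c * h) x \<in> L}"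
  have N: "V.subspace N"
  proof (rule V.subspaceI)
    show "0 \<in> N"
      unfolding N_def using V.subspace_0[OF subspace_L]
      by (auto intro!: exI[of _ 0] simp: diag_def zero_vec_def)
  next
    fix v w assume "v \<in> N" "w \<in> N"
    then obtain c d where c: "c $ m = 0" "c $ r = 0" "v - diag (c * h) x \<in> L"
      and d: "d $ m = 0" "d $ r = 0" "w - diag (d * h) x \<in> L"
      by (auto simp: N_def)
    have eq: "v + w - diag ((c + d) * h) x = (v - diag (c * h) x) + (w - diag (d * h) x)"
      by (simp add: distrib_right diag_add)
    have "v + w - diag ((c + d) * h) x \<in> L"
      unfolding eq by (intro V.subspace_add[OF subspace_L] c d)
    with c d show "v + w \<in> N"
      unfolding N_def by (intro CollectI exI[of _ "c + d"]) simp
  next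
    fix b v assume "v \<in> N"
    then obtain c where c: "c $ m = 0" "c $ r = 0" "v - diag (c * h) x \<in> L"
      by (auto simp: N_def)
    have "(b *s c) * h = b *s (c * h)"
      by (simp add: vec_eq_iff)
    then have eq: "vec_scale smul b v - diag ((b *s c) * h) x = vec_scale smul b (v - diag (c * h) x)"
      by (simp only: diag_scale V.scale_right_diff_distrib)
    have "vec_scale smul b v - diag ((b *s c) * h) x \<in> L"
      unfolding eq by (intro V.subspace_scale[OF subspace_L] c)
    with c show "vec_scale smul b v \<in> N"
      unfolding N_def by (intro CollectI exI[of _ "b *s c"]) simp
  qed
  have L_N: "L \<subseteq> N"
    by (auto simp: N_def diag_def zero_vec_def[symmetric] intro!: exI[of _ 0])
  have "diag (axis r 1 * h) x \<notin> N"
  proof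
    assume "diag (axis r 1 * h) x \<in> N"
    then obtain c where c: "c $ m = 0" "c $ r = 0" "diag (axis r 1 * h) x - diag (c * h) x \<in> L"
      by (auto simp: N_def)
    then have "diag ((axis r 1 - c) * h) x \<in> L"
      by (simp add: left_diff_distrib diag_diff)
    moreover have "(axis r 1 - c) $ m = 0"
      using False c by (simp add: axis_def)
    ultimately have "(axis r 1 - c) * h = 0"
      by (rule unique)
    then have "((axis r 1 - c) * h) $ r = 0" by simp
    with c r show False by (simp add: axis_def)
  qed
  from V.functional_separating_subspace[OF N this]
  obtain \<psi> where \<psi>: "Vector_Spaces.linear (vec_scale smul) (*) \<psi>"
    "\<And>v. v \<in> N \<Longrightarrow> \<psi> v = 0" "\<psi> (diag (axis r 1 * h) x) = 1"
    by blast
  interpret psi: Vector_Spaces.linear "vec_scale smul" "(*)" \<psi> by fact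
  show ?thesis
  proof (rule that[of \<psi>])
    fix g :: "'k ^ 'n" assume g: "g $ m = 1"
    define c where "c = g - 1 - (g $ r - 1) *s axis r 1"
    have "c $ m = 0" "c $ r = 0"
      using g False by (auto simp: c_def axis_def)
    then have "diag (c * h) x \<in> N"
      unfolding N_def using V.subspace_0[OF subspace_L] by (intro CollectI exI[of _ c]) simp
    moreover have "g * h = h + ((g $ r - 1) *s (axis r 1 * h) + c * h)"
      by (simp add: c_def vec_eq_iff algebra_simps)
    then have "diag (g * h) x =
        diag h x + (vec_scale smul (g $ r - 1) (diag (axis r 1 * h) x) + diag (c * h) x)"
      by (simp only: diag_add diag_scale)
    ultimately show "\<psi> (diag (g * h) x) = g $ r - 1"
      using h L_N by (simp add: psi.add psi.scale \<psi> subset_iff)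
  qed (use \<psi> L_N in auto)
qed

text \<open>Functionals vanishing on \<open>L\<close> turn membership of
  \<open>diag (g * h) (x + smul t u)\<close> into a linear system for \<open>g\<close>.
  Unimodularity forces \<open>g = 1\<close> on \<open>J\<close> for some nonzero \<open>t\<close>,
  and subtracting \<open>diag h x\<close> isolates \<open>diag h u\<close>.\<close>

lemma diag_in_L:
  assumes h: "diag h x \<in> L" "\<And>i. h $ i \<noteq> 0 \<longleftrightarrow> i \<in> J"
    and unique: "\<And>g. diag (g * h) x \<in> L \<Longrightarrow> g $ m = 0 \<Longrightarrow> g * h = 0"
    and m: "m \<in> J" "\<And>i. i \<in> J \<Longrightarrow> norm (z i) \<le> norm (z m)"
  shows "diag h u \<in> L"
proof -
  have h0: "h $ i = 0" if "i \<notin> J" for i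
    using h(2) that by blast
  have same_norm: "norm (z i) = norm (z m)" if i: "i \<in> J" for i
  proof (rule ccontr)
    assume "norm (z i) \<noteq> norm (z m)"
    with m(2)[OF i] have less: "norm (z i) < norm (z m)" by simp
    \<comment> \<open>At \<open>y = x\<close> the multiplier \<open>g - 1\<close> vanishes at
      \<open>m\<close>, so \<open>unique\<close> makes \<open>g\<close> equal to 1 on
      \<open>J\<close>, against the strict bound at \<open>i\<close>.\<close>
    obtain g where g: "g $ m = 1" "diag (g * h) x \<in> L"
      "\<And>i. i \<in> J \<Longrightarrow> norm (z i) < norm (z m) \<Longrightarrow> norm (g $ i) < 1"
      using limit_multiplier[OF h(1) h0 m, of x] by metis
    have "diag ((g - 1) * h) x \<in> L"
      using V.subspace_diff[OF subspace_L g(2) h(1)] by (simp add: left_diff_distrib diag_diff)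
    then have "(g - 1) * h = 0"
      by (rule unique) (simp add: g)
    then have "((g - 1) * h) $ i = 0" by simp
    with h(2)[of i] i have "g $ i = 1" by simp
    with g(3)[OF i less] show False by simp
  qed
  \<comment> \<open>The properties are bundled so that one functional can be chosen for each
    \<open>r\<close>.\<close>
  define P where "P r \<psi> \<longleftrightarrow> Vector_Spaces.linear (vec_scale smul) (*) \<psi> \<and> (\<forall>v\<in>L. \<psi> v = 0) \<and>
      (\<forall>g. g $ m = 1 \<longrightarrow> \<psi> (diag (g * h) x) = g $ r - 1)" for r \<psi>
  have "\<exists>\<psi>. P r \<psi>" if r: "r \<in> J" for r
  proof -
    have "h $ r \<noteq> 0" using h(2) r by blast
    from coordinate_functional[OF h(1) unique this] show ?thesis
      unfolding P_def by metis
  qed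
  then obtain \<psi> where P: "\<And>r. r \<in> J \<Longrightarrow> P r (\<psi> r)"
    by metis
  then have lin: "\<And>r. r \<in> J \<Longrightarrow> Vector_Spaces.linear (vec_scale smul) (*) (\<psi> r)"
    and vanish: "\<And>r v. r \<in> J \<Longrightarrow> v \<in> L \<Longrightarrow> \<psi> r v = 0"
    and coord: "\<And>r g. r \<in> J \<Longrightarrow> g $ m = 1 \<Longrightarrow> \<psi> r (diag (g * h) x) = g $ r - 1"
    unfolding P_def by blast+
  define M where "M r s = \<psi> r (diag (axis s 1 * h) u)" for r s
  have "finite J" by simp
  have multiplier: "\<exists>g. diag (g * h) (x + smul t u) \<in> L \<and> (\<forall>r\<in>J. norm (g $ r) = 1) \<and>
      (\<forall>r\<in>J. g $ r = 1 - t * (\<Sum>s\<in>J. g $ s * M r s))" for t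
  proof -
    obtain g where g: "g $ m = 1" "diag (g * h) (x + smul t u) \<in> L"
      "\<And>i. i \<in> J \<Longrightarrow> norm (z i) = norm (z m) \<Longrightarrow> norm (g $ i) = 1"
      using limit_multiplier[OF h(1) h0 m, of "x + smul t u"] by metis
    have "g $ r = 1 - t * (\<Sum>s\<in>J. g $ s * M r s)" if r: "r \<in> J" for r
    proof -
      interpret psi: Vector_Spaces.linear "vec_scale smul" "(*)" "\<psi> r"
        using lin[OF r] .
      have "g * h = (\<Sum>s\<in>J. g $ s *s (axis s 1 * h))"
      proof (rule vec_eq_iff[THEN iffD2], rule allI)
        fix i
        have "(\<Sum>s\<in>J. g $ s *s (axis s 1 * h)) $ i = (\<Sum>s\<in>J. if s = i then g $ i * h $ i else 0)"
          unfolding sum_component by (rule sum.cong) (auto simp: axis_def)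
        also have "\<dots> = (g * h) $ i"
          using h0[of i] by simp
        finally show "(g * h) $ i = (\<Sum>s\<in>J. g $ s *s (axis s 1 * h)) $ i" by simp
      qed
      moreover have "diag (sum f J) u = (\<Sum>s\<in>J. diag (f s) u)" for f
        using \<open>finite J\<close>
        by (induction J rule: finite_induct) (auto simp: diag_add, simp add: vec_eq_iff)
      ultimately have "diag (g * h) u = (\<Sum>s\<in>J. vec_scale smul (g $ s) (diag (axis s 1 * h) u))"
        by (simp add: diag_scale)
      then have u: "\<psi> r (diag (g * h) u) = (\<Sum>s\<in>J. g $ s * M r s)"
        by (simp add: psi.sum psi.scale M_def)
      have "0 = \<psi> r (diag (g * h) (x + smul t u))"
        using vanish[OF r g(2)] by simp
      also have "\<dots> = (g $ r - 1) + t * (\<Sum>s\<in>J. g $ s * M r s)"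
        by (simp only: diag_add_right diag_scale_right psi.add psi.scale coord[OF r g(1)] u)
      finally show ?thesis by (simp add: algebra_simps)
    qed
    with g same_norm show ?thesis by blast
  qed
  have "\<exists>g. \<forall>r\<in>J. norm (g r) = 1 \<and> g r = 1 - t * (\<Sum>s\<in>J. g s * M r s)" for t
    using multiplier[of t] by (elim exE) (rule exI[of _ "\<lambda>r. _ $ r"], blast)
  from unimodular_perturbation_trivial[OF \<open>finite J\<close> this]
  obtain t where t: "t \<noteq> 0"
    and trivial: "\<And>g r. (\<And>q. q \<in> J \<Longrightarrow> g q = 1 - t * (\<Sum>s\<in>J. g s * M q s)) \<Longrightarrow> r \<in> J \<Longrightarrow> g r = 1"
    by blast
  obtain g where g: "diag (g * h) (x + smul t u) \<in> L"
    "\<forall>r\<in>J. g $ r = 1 - t * (\<Sum>s\<in>J. g $ s * M r s)"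
    using multiplier[of t] by blast
  have "g $ r = 1" if "r \<in> J" for r
    using trivial[of "\<lambda>r. g $ r"] g(2) that by blast
  then have "(g * h) $ i = h $ i" for i
    using h0[of i] by (cases "i \<in> J") auto
  then have "g * h = h" by (simp add: vec_eq_iff)
  with g(1) have "diag h x + vec_scale smul t (diag h u) \<in> L"
    by (simp add: diag_add_right diag_scale_right)
  then have "(diag h x + vec_scale smul t (diag h u)) - diag h x \<in> L"
    using h(1) V.subspace_diff[OF subspace_L] by blast
  then have "vec_scale smul t (diag h u) \<in> L"
    by simp
  then have "vec_scale smul (inverse t) (vec_scale smul t (diag h u)) \<in> L"
    by (rule V.subspace_scale[OF subspace_L])
  with t show ?thesis by simp
qed

section \<open>Induction on the support\<close>

text \<open>All \<open>diag h u\<close> lie in \<open>L\<close>. Applying the operator and density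
  of the range of \<open>T\<close> put \<open>diag (\<chi> i. z i * h $ i) x\<close> in
  \<open>L\<close>, so this multiplier is proportional to \<open>h\<close>. Distinct
  \<open>z i\<close> then leave only one index in \<open>J\<close>.\<close>

lemma supported_in_L_unique:
  assumes h: "diag h x \<in> L" "\<And>i. h $ i \<noteq> 0 \<longleftrightarrow> i \<in> J" and "J \<noteq> {}"
    and unique: "\<And>g. (\<And>i. i \<notin> J \<Longrightarrow> g $ i = 0) \<Longrightarrow> diag g x \<in> L \<Longrightarrow> \<exists>c. g = c *s h"
    and v: "\<And>i. i \<notin> J \<Longrightarrow> v $ i = 0"
  shows "v \<in> L"
proof -
  obtain m where m: "m \<in> J" "\<And>i. i \<in> J \<Longrightarrow> norm (z i) \<le> norm (z m)"
    using finite_imageI[of J "\<lambda>i. norm (z i)"] Max_in[of "(\<lambda>i. norm (z i)) ` J"]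
      Max_ge[of "(\<lambda>i. norm (z i)) ` J"] \<open>J \<noteq> {}\<close> by fastforce
  have hm: "h $ m \<noteq> 0" using h(2) m(1) by blast
  have all_diag: "diag h u \<in> L" for u
  proof (rule diag_in_L[OF h _ m])
    fix g assume g: "diag (g * h) x \<in> L" "g $ m = 0"
    have "(g * h) $ i = 0" if "i \<notin> J" for i
      using h(2)[of i] that by simp
    then obtain c where c: "g * h = c *s h"
      using unique g(1) by blast
    then have "(g * h) $ m = (c *s h) $ m" by simp
    with g(2) hm have "c = 0" by simp
    with c show "g * h = 0" by (simp add: vec_eq_iff)
  qed
  define w where "w = (\<chi> i. z i * h $ i)"
  have Tu: "diag w (T u) \<in> L" for u
    using power_in_L[OF all_diag[of u], of 1] unfolding power_diag by (simp add: w_def)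
  have "{smul s ((T ^^ Suc k) x) | s k. True} \<subseteq> {y. diag w y \<in> L}"
    using V.subspace_scale[OF subspace_L Tu] by (auto simp: diag_scale_right)
  then have "diag w x \<in> L"
    using closure_minimal[OF _ closed_diag_in_L] tail_dense by blast
  moreover have "w $ i = 0" if "i \<notin> J" for i
    using h(2)[of i] that by (simp add: w_def)
  ultimately obtain c where c: "w = c *s h"
    using unique by blast
  have "z i = c" if "i \<in> J" for i
  proof -
    have "w $ i = (c *s h) $ i" using c by simp
    with h(2)[of i] that show ?thesis by (simp add: w_def)
  qed
  with m(1) inj_z have J: "i = m" if "i \<in> J" for i
    using that by (metis injD)
  \<comment> \<open>As \<open>J\<close> is the singleton of \<open>m\<close>, dividing by
    \<open>h $ m\<close> exhibits \<open>v\<close> as \<open>diag h a\<close>.\<close>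
  define a where "a = smul (inverse (h $ m)) (v $ m)"
  have "v $ i = diag h a $ i" for i
  proof (cases "i = m")
    case True
    with hm show ?thesis by (simp add: a_def)
  next
    case False
    with J have "i \<notin> J" by blast
    with v[of i] h(2)[of i] show ?thesis by simp
  qed
  then have "v = diag h a"
    by (simp add: vec_eq_iff)
  with all_diag show ?thesis by simp
qed

text \<open>A second, non-proportional multiplier splits the support of \<open>h\<close> into two
  smaller parts, each carrying a multiplier in \<open>L\<close>; otherwise the unique case
  applies.\<close>

lemma supported_in_L:
  assumes "diag h x \<in> L" "\<And>i. h $ i = 0 \<Longrightarrow> v $ i = 0"
  shows "v \<in> L"
  using assms
proof (induction "card {i. h $ i \<noteq> 0}" arbitrary: h v rule: less_induct)
  case less
  let ?J = "{i. h $ i \<noteq> 0}"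
  show ?case
  proof (cases "(\<forall>g. (\<forall>i. i \<notin> ?J \<longrightarrow> g $ i = 0) \<longrightarrow> diag g x \<in> L \<longrightarrow> (\<exists>c. g = c *s h)) \<or> ?J = {}")
    case True
    show ?thesis
    proof (cases "?J = {}")
      case True
      with less.prems(2) have "v = 0" by (simp add: vec_eq_iff)
      then show ?thesis using V.subspace_0[OF subspace_L] by simp
    next
      case False
      show ?thesis
      proof (rule supported_in_L_unique[OF less.prems(1) _ False])
        show "\<exists>c. g = c *s h" if "\<And>i. i \<notin> ?J \<Longrightarrow> g $ i = 0" "diag g x \<in> L" for g
          using True False that by blast
      qed (use less.prems(2) in auto)
    qed
  next
    case False
    then obtain g j where g: "\<And>i. h $ i = 0 \<Longrightarrow> g $ i = 0" "diag g x \<in> L"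
      and not_mult: "\<And>c. g \<noteq> c *s h" and j: "h $ j \<noteq> 0"
      by auto
    \<comment> \<open>The subtracted multiple cancels coordinate \<open>j\<close>, so the support
      shrinks; \<open>g'\<close> is nonzero because \<open>g\<close> is no multiple of
      \<open>h\<close>.\<close>
    define g' where "g' = g - (g $ j / h $ j) *s h"
    have g': "diag g' x \<in> L"
      unfolding g'_def diag_diff diag_scale
      by (intro V.subspace_diff[OF subspace_L] V.subspace_scale[OF subspace_L] g(2) less.prems(1))
    have supp: "h $ i \<noteq> 0" if "g' $ i \<noteq> 0" for i
      using that g(1)[of i] by (auto simp: g'_def)
    have "g' $ j = 0" using j by (simp add: g'_def)
    with j supp have "card {i. g' $ i \<noteq> 0} < card ?J"
      by (intro psubset_card_mono) auto
    then have sub1: "w \<in> L" if "\<And>i. g' $ i = 0 \<Longrightarrow> w $ i = 0" for w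
      using less.hyps[OF _ g'] that by blast
    have "g' \<noteq> 0" using not_mult by (simp add: g'_def)
    then obtain l where l: "g' $ l \<noteq> 0" by (auto simp: vec_eq_iff)
    \<comment> \<open>The supports of \<open>g'\<close> and \<open>h'\<close> partition that of
      \<open>h\<close>. The part \<open>h - h'\<close> is already handled by
      \<open>sub1\<close>.\<close>
    define h' where "h' = (\<chi> i. if g' $ i = 0 then h $ i else 0)"
    have "diag (h - h') x \<in> L"
      by (rule sub1) (simp add: h'_def)
    with less.prems(1) have "diag h x - diag (h - h') x \<in> L"
      by (rule V.subspace_diff[OF subspace_L])
    then have h': "diag h' x \<in> L" by (simp add: diag_diff)
    have "card {i. h' $ i \<noteq> 0} < card ?J"
      using l supp[OF l] by (intro psubset_card_mono) (auto simp: h'_def split: if_splits)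
    then have sub2: "w \<in> L" if "\<And>i. h' $ i = 0 \<Longrightarrow> w $ i = 0" for w
      using less.hyps[OF _ h'] that by blast
    define v1 where "v1 = (\<chi> i. if g' $ i = 0 then 0 else v $ i)"
    have "v1 \<in> L" by (rule sub1) (simp add: v1_def)
    moreover have "v - v1 \<in> L"
      by (rule sub2) (auto simp: h'_def v1_def less.prems(2) split: if_splits)
    ultimately have "v1 + (v - v1) \<in> L" by (rule V.subspace_add[OF subspace_L])
    then show ?thesis by simp
  qed
qed

lemma L_eq_UNIV:
  assumes "diag 1 x \<in> L"
  shows "L = UNIV"
  using supported_in_L[OF assms] by auto

end

section \<open>Cyclicity of the direct sum\<close>

text \<open>The cyclic vector is the constant vector of a supercyclic \<open>x\<close>. The
  Heine-Borel scalar field covers the real and the complex case at once.\<close>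

theorem cyclic_direct_sum_multiples:
  fixes smul :: "'k::{real_normed_field, heine_borel} \<Rightarrow> 'a::{topological_ab_group_add, t2_space} \<Rightarrow> 'a"
    and z :: "'n::finite \<Rightarrow> 'k"
  assumes tvs: "topological_vector_space smul" and "infinite_dimensional smul"
    and T: "continuous_linear_operator smul T" and "supercyclic_operator smul T"
    and "inj z" and "\<And>i. z i \<noteq> 0"
  shows "cyclic_operator (vec_scale smul) (direct_sum_multiples smul z T)"
proof -
  let ?D = "direct_sum_multiples smul z T"
  interpret topological_vector_space smul by fact
  interpret heine_borel_tvs smul ..
  interpret V: topological_vector_space "vec_scale smul :: 'k \<Rightarrow> 'a ^ 'n \<Rightarrow> 'a ^ 'n"
    using tvs by (rule topological_vector_space_vec_scale)
  have "continuous_linear_operator (vec_scale smul) ?D"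
    using tvs T by (rule continuous_linear_operator_direct_sum_multiples)
  then have lin_D: "Vector_Spaces.linear (vec_scale smul) (vec_scale smul) ?D"
    and cont_D: "continuous_on UNIV ?D"
    by (simp_all add: continuous_linear_operator_def)
  interpret D: Vector_Spaces.linear "vec_scale smul" "vec_scale smul" ?D by fact
  obtain x where x: "closure {smul s ((T ^^ k) x) | s k. True} = UNIV"
    using assms(4) by (auto simp: supercyclic_operator_def)
  define e :: "'a ^ 'n" where "e = (\<chi> i. x)"
  let ?S = "V.span {(?D ^^ k) e | k. True}"
  have "?D ` ?S = V.span (?D ` {(?D ^^ k) e | k. True})"
    by (rule D.span_image[symmetric])
  also have "\<dots> \<subseteq> ?S"
  proof (rule V.span_mono, rule image_subsetI)
    fix v assume "v \<in> {(?D ^^ k) e | k. True}"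
    then obtain k where "v = (?D ^^ k) e" by blast
    then have "?D v = (?D ^^ Suc k) e" by simp
    then show "?D v \<in> {(?D ^^ k) e | k. True}" by blast
  qed
  \<comment> \<open>Continuity carries invariance of the span over to its closure.\<close>
  finally have "?D ` ?S \<subseteq> closure ?S"
    using closure_subset[of ?S] by (rule subset_trans)
  then have D_closure: "?D ` closure ?S \<subseteq> closure ?S"
    by (rule image_closure_subset[OF continuous_on_subset[OF cont_D subset_UNIV] closed_closure])
  interpret supercyclic_multiples smul T x z "closure ?S"
  proof (intro supercyclic_multiples.intro supercyclic_multiples_axioms.intro)
    show "Vector_Spaces.linear smul smul T"
      using T by (simp add: continuous_linear_operator_def)
    show "closure {smul s ((T ^^ Suc k) x) | s k. True} = UNIV"
      by (rule supercyclic_tail_dense[OF assms(2) x])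
    show "V.subspace (closure ?S)"
      by (rule V.closure_subspace[OF V.subspace_span])
    show "?D v \<in> closure ?S" if "v \<in> closure ?S" for v
      using D_closure that by blast
  qed (fact heine_borel_tvs_axioms, fact assms(5), fact assms(6), rule closed_closure)
  have "(?D ^^ 0) e \<in> {(?D ^^ k) e | k. True}" by blast
  then have "(?D ^^ 0) e \<in> ?S" by (rule V.span_base)
  then have "(?D ^^ 0) e \<in> closure ?S" by (rule subsetD[OF closure_subset])
  moreover have "(?D ^^ 0) e = diag 1 x" by (simp add: e_def vec_eq_iff)
  ultimately have "closure ?S = UNIV" by (intro L_eq_UNIV) (simp only:)
  then show ?thesis unfolding cyclic_operator_def by blast
qed

theorem theorem1p4:
  shows "(\<forall>(smul :: real \<Rightarrow> 'a::{topological_ab_group_add, t2_space} \<Rightarrow> 'a) (T :: 'a \<Rightarrow> 'a)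
            (z :: 'n::finite \<Rightarrow> real).
            topological_vector_space smul \<and> infinite_dimensional smul \<and>
            continuous_linear_operator smul T \<and> supercyclic_operator smul T \<and>
            inj z \<and> (\<forall>i. z i \<noteq> 0)
            \<longrightarrow> cyclic_operator (vec_scale smul) (direct_sum_multiples smul z T))
       \<and> (\<forall>(smul :: complex \<Rightarrow> 'a::{topological_ab_group_add, t2_space} \<Rightarrow> 'a) (T :: 'a \<Rightarrow> 'a)
            (z :: 'n::finite \<Rightarrow> complex).
            topological_vector_space smul \<and> infinite_dimensional smul \<and>
            continuous_linear_operator smul T \<and> supercyclic_operator smul T \<and>
            inj z \<and> (\<forall>i. z i \<noteq> 0)
            \<longrightarrow> cyclic_operator (vec_scale smul) (direct_sum_multiples smul z T))"
  by (simp add: cyclic_direct_sum_multiples)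

end
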